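(* Let $(X,d)$ be a compact metric space for which there are a finite alphabet $A$, constants $r\in(0,1)$ and $C>1$, and a collection of nonempty closed connected subsets $\{X_w:w\in A^*\}$ of $X$ such that: (1) $X_\varepsilon=X$; (2) for all $w\in A^*$ and $i\in A$, $X_{wi}\subset X_w$, and moreover $\bigcup_{i\in A}X_{wi}=X_w$; (3) for all $w\in A^*$, $C^{-1}r^{|w|}\le\operatorname{diam}X_w\le C r^{|w|}$; (4) if $k\in\mathbb{N}$ and $w,u\in A^k$ satisfy $X_w\cap X_u=\emptyset$, then $\operatorname{dist}(X_w,X_u)\ge C^{-1}r^k$. For each $k\in\mathbb{N}$ let $G_k=(A^k,E_k)$ be the graph in which distinct words $w,u\in A^k$ are adjacent if and only if $X_w\cap X_u\ne\emptyset$, let $\mathscr{C}=(A,(G_k)_{k\in\mathbb{N}})$ (which is combinatorial data), and let $\Delta:A^*\to[0,1]$, $\Delta(w)=r^{|w|}$. Then $(X,d)$ is bi-Lipschitz homeomorphic to $(\mathcal{A},d_{\mathscr{C},\Delta})$.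
   Context: Words. A finite alphabet is $A=\{1,\dots,M\}$ with $M\ge2$ an integer. $A^k$ is the set of words of length $k$ ($A^0=\{\varepsilon\}$, the empty word), $A^*=\bigcup_{k\ge0}A^k$, $A^{\mathbb{N}}$ is the set of infinite words, $|w|$ is the length of $w$, and for $u\in A^*$, $A^{\mathbb{N}}_u$ is the set of infinite words beginning with $u$. Combinatorial data. $\mathscr{C}=(A,(G_k)_{k\in\mathbb{N}})$ where, for each $k\in\mathbb{N}$, $G_k=(A^k,E_k)$ is a connected graph such that (a) for each $w\in A^k$ the subgraph of $G_{k+1}$ induced by $\{wi:i\in A\}$ is connected; (b) if $\{w,u\}\in E_k$ then there is $(i,j)\in A\times A$ with $\{wi,uj\}\in E_{k+1}$. Chains. For $u_1,u_2\in A^*$, $A^{\mathbb{N}}_{u_1}$ and $A^{\mathbb{N}}_{u_2}$ combinatorially intersect if for each $n>\max\{|u_1|,|u_2|\}$ there are words $w_1,w_2\in A^n$ beginning with $u_1$ and $u_2$ respectively that are adjacent in $G_n$. A chain joining $w,w'\in A^{\mathbb{N}}$ is a finite sequence $A^{\mathbb{N}}_{w_1},\dots,A^{\mathbb{N}}_{w_n}$ with $w\in A^{\mathbb{N}}_{w_1}$, $w'\in A^{\mathbb{N}}_{w_n}$ and consecutive members combinatorially intersecting. The space. For $w,u\in A^{\mathbb{N}}$ let $D_{\mathscr{C},\Delta}(w,u)=\inf\sum_i\Delta(v_i)$, the infimum over all chains $\{A^{\mathbb{N}}_{v_i}\}$ joining $w$ with $u$. This is a pseudometric; $\mathcal{A}=A^{\mathbb{N}}/\!\sim$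 where $w\sim w'$ iff $D_{\mathscr{C},\Delta}(w,w')=0$, and $d_{\mathscr{C},\Delta}([w],[v])=D_{\mathscr{C},\Delta}(w,v)$ is the induced metric. A bi-Lipschitz homeomorphism is a bijection $f$ with $L^{-1}d(x,y)\le d(f(x),f(y))\le L\,d(x,y)$ for some $L\ge1$ and all $x,y$. *)

theory Defs
  imports "HOL-Analysis.Analysis" "HOL-Library.FuncSet" "HOL-Library.Sublist"
    "Graph_Theory.Graph_Theory"
begin

definition words :: "nat \<Rightarrow> nat list set" where
  "words M = lists {1..M}"

definition words_of_length :: "nat \<Rightarrow> nat \<Rightarrow> nat list set" where
  "words_of_length M k = {w \<in> words M. length w = k}"

definition infinite_words :: "nat \<Rightarrow> (nat \<Rightarrow> nat) set" where
  "infinite_words M = (UNIV \<rightarrow> {1..M})"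

definition cylinder :: "nat \<Rightarrow> nat list \<Rightarrow> (nat \<Rightarrow> nat) set" where
  "cylinder M u = {x \<in> infinite_words M. map x [0..<length u] = u}"

(* Undirected simple graphs are the symmetric loop-free digraphs (pair_graph) of
   Graph_Theory: an edge {w,u} is the pair of arcs (w,u), (u,w).  The constant
   Digraph_Component.connected is graph connectedness, as opposed to the topological
   notion of the same base name. *)
definition combinatorial_data :: "nat \<Rightarrow> (nat \<Rightarrow> nat list pair_pre_digraph) \<Rightarrow> bool" where
  "combinatorial_data M G \<longleftrightarrow>
     2 \<le> M \<and>
     (\<forall>k. pair_graph (G k) \<and> pverts (G k) = words_of_length M k \<and>
          Digraph_Component.connected (with_proj (G k))) \<and>
     (\<forall>k. \<forall>w\<in>words_of_length M k.
          Digraph_Component.connected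
            (with_proj (G (Suc k)) \<restriction> ((\<lambda>i. w @ [i]) ` {1..M}))) \<and>
     (\<forall>k w u. (w, u) \<in> parcs (G k) \<longrightarrow>
          (\<exists>i\<in>{1..M}. \<exists>j\<in>{1..M}. (w @ [i], u @ [j]) \<in> parcs (G (Suc k))))"

definition combinatorially_intersect ::
    "nat \<Rightarrow> (nat \<Rightarrow> nat list pair_pre_digraph) \<Rightarrow> nat list \<Rightarrow> nat list \<Rightarrow> bool" where
  "combinatorially_intersect M G u1 u2 \<longleftrightarrow>
     (\<forall>n > max (length u1) (length u2).
        \<exists>w1\<in>words_of_length M n. \<exists>w2\<in>words_of_length M n.
          prefix u1 w1 \<and> prefix u2 w2 \<and> (w1, w2) \<in> parcs (G n))"

(* A chain of cylinders is represented by the list of the words indexing them. *)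
definition chain_joining ::
    "nat \<Rightarrow> (nat \<Rightarrow> nat list pair_pre_digraph) \<Rightarrow> (nat \<Rightarrow> nat) \<Rightarrow> (nat \<Rightarrow> nat)
      \<Rightarrow> nat list list \<Rightarrow> bool" where
  "chain_joining M G w w' vs \<longleftrightarrow>
     vs \<noteq> [] \<and> set vs \<subseteq> words M \<and> w \<in> cylinder M (hd vs) \<and> w' \<in> cylinder M (last vs) \<and>
     successively (combinatorially_intersect M G) vs"

definition chain_pseudometric ::
    "nat \<Rightarrow> (nat \<Rightarrow> nat list pair_pre_digraph) \<Rightarrow> (nat list \<Rightarrow> real)
      \<Rightarrow> (nat \<Rightarrow> nat) \<Rightarrow> (nat \<Rightarrow> nat) \<Rightarrow> real" where
  "chain_pseudometric M G \<Delta> w u = Inf {sum_list (map \<Delta> vs) | vs. chain_joining M G w u vs}"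

definition chain_space ::
    "nat \<Rightarrow> (nat \<Rightarrow> nat list pair_pre_digraph) \<Rightarrow> (nat list \<Rightarrow> real) \<Rightarrow> (nat \<Rightarrow> nat) set set" where
  "chain_space M G \<Delta> = infinite_words M //
     {(w, w'). w \<in> infinite_words M \<and> w' \<in> infinite_words M \<and> chain_pseudometric M G \<Delta> w w' = 0}"

(* The value of the pseudometric on any representatives of the two classes; the value 0
   outside the quotient is there because the locale Metric_space also constrains the
   distance function off the carrier. *)
definition chain_metric ::
    "nat \<Rightarrow> (nat \<Rightarrow> nat list pair_pre_digraph) \<Rightarrow> (nat list \<Rightarrow> real)
      \<Rightarrow> (nat \<Rightarrow> nat) set \<Rightarrow> (nat \<Rightarrow> nat) set \<Rightarrow> real" where
  "chain_metric M G \<Delta> P Q =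
     (if P \<in> chain_space M G \<Delta> \<and> Q \<in> chain_space M G \<Delta>
      then the_elem {chain_pseudometric M G \<Delta> w v | w v. w \<in> P \<and> v \<in> Q}
      else 0)"

definition bilipschitz_homeomorphic ::
    "'a set \<Rightarrow> ('a \<Rightarrow> 'a \<Rightarrow> real) \<Rightarrow> 'b set \<Rightarrow> ('b \<Rightarrow> 'b \<Rightarrow> real) \<Rightarrow> bool" where
  "bilipschitz_homeomorphic X d Y e \<longleftrightarrow>
     (\<exists>f L. bij_betw f X Y \<and> 1 \<le> L \<and>
        (\<forall>x\<in>X. \<forall>y\<in>X. inverse L * d x y \<le> e (f x) (f y) \<and> e (f x) (f y) \<le> L * d x y))"

definition intersection_graph ::
    "nat \<Rightarrow> (nat list \<Rightarrow> 'a set) \<Rightarrow> nat \<Rightarrow> nat list pair_pre_digraph" where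
  "intersection_graph M Y k =
     \<lparr> pverts = words_of_length M k,
       parcs = {(w, u). w \<in> words_of_length M k \<and> u \<in> words_of_length M k \<and>
                        w \<noteq> u \<and> Y w \<inter> Y u \<noteq> {}} \<rparr>"

end

theory Submission
  imports Defs
begin

text \<open>
  Two cylinders combinatorially intersect exactly when the corresponding cells \<open>Y u\<close>, \<open>Y v\<close> meet
  (for comparable words, connectedness of a cell forces two distinct subcells to meet).
  The cells along an infinite word shrink to a single point, which gives a surjection from
  the infinite words onto \<open>X\<close>. A chain of cells joining two points has total diameter at least
  their distance, so the distance is at most \<open>C\<close> times the chain pseudometric. Conversely, if \<open>n\<close>
  is the first level at which the cells along two words are disjoint, their points are at
  distance at least \<open>r ^ n / C\<close>, while the two meeting cells of level \<open>n - 1\<close> form a chain of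
  length \<open>2 * r ^ (n - 1)\<close>.
\<close>

section \<open>Words\<close>

lemma words_append_iff [simp]: "u @ v \<in> words M \<longleftrightarrow> u \<in> words M \<and> v \<in> words M"
  by (auto simp: words_def)

lemma Nil_in_words [simp]: "[] \<in> words M"
  by (simp add: words_def)

lemma Cons_in_words_iff [simp]: "i # u \<in> words M \<longleftrightarrow> 1 \<le> i \<and> i \<le> M \<and> u \<in> words M"
  by (auto simp: words_def)

lemma words_of_length_subset: "w \<in> words_of_length M k \<Longrightarrow> w \<in> words M"
  by (simp add: words_of_length_def)

lemma finite_words_of_length: "finite (words_of_length M k)"
proof -
  have "words_of_length M k = {xs. set xs \<subseteq> {1..M} \<and> length xs = k}"
    by (auto simp: words_of_length_def words_def)
  then show ?thesis
    by (simp add: finite_lists_length_eq)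
qed

lemma map_upt_in_words:
  assumes "w \<in> infinite_words M"
  shows "map w [0..<n] \<in> words M"
  using assms by (auto simp: words_def infinite_words_def in_lists_conv_set)

lemma cylinder_Nil: "cylinder M [] = infinite_words M"
  by (simp add: cylinder_def)

lemma in_cylinder_map_upt: "w \<in> infinite_words M \<Longrightarrow> w \<in> cylinder M (map w [0..<n])"
  by (simp add: cylinder_def)

section \<open>Connectedness of intersection graphs\<close>

text \<open>If some vertex were unreachable from \<open>u\<close>, the cells of the reachable
  vertices and those of the others would split the connected union into two disjoint nonempty closed
  sets. A general \<open>pre_digraph\<close> is allowed so that both the level graphs and their
  induced subgraphs on siblings are covered.\<close>

lemma connected_intersection_digraph:
  fixes Y :: "'b \<Rightarrow> 'a::topological_space set" and H :: "('b, 'c) pre_digraph"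
  assumes fin: "finite (verts H)" and ne: "verts H \<noteq> {}"
    and cl: "\<And>u. u \<in> verts H \<Longrightarrow> closed (Y u)"
    and nonempty: "\<And>u. u \<in> verts H \<Longrightarrow> Y u \<noteq> {}"
    and conn: "Topological_Spaces.connected (\<Union>u\<in>verts H. Y u)"
    and arcs: "\<And>u v. u \<in> verts H \<Longrightarrow> v \<in> verts H \<Longrightarrow> u \<noteq> v \<Longrightarrow> Y u \<inter> Y v \<noteq> {} \<Longrightarrow>
      (u, v) \<in> arcs_ends H"
  shows "Digraph_Component.connected H"
proof -
  have "v \<in> {v \<in> verts H. u \<rightarrow>\<^sup>*\<^bsub>with_proj (mk_symmetric H)\<^esub> v}" (is "_ \<in> ?R")
    if u: "u \<in> verts H" and v: "v \<in> verts H" for u v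
  proof (rule ccontr)
    assume nv: "v \<notin> ?R"
    let ?A = "\<Union>w\<in>?R. Y w" and ?B = "\<Union>w\<in>verts H - ?R. Y w"
    have uR: "u \<in> ?R"
      using u by (simp add: reachable_def rtrancl_on_refl)
    \<comment> \<open>Reachability spreads along meeting cells, so \<open>?A\<close> and
      \<open>?B\<close> are disjoint.\<close>
    have step: "w' \<in> ?R" if w: "w \<in> ?R" and w': "w' \<in> verts H" and meet: "Y w \<inter> Y w' \<noteq> {}" for w w'
    proof (cases "w = w'")
      case False
      then have "(w, w') \<in> arcs_ends H"
        using arcs w w' meet by blast
      then have "(w, w') \<in> parcs (mk_symmetric H)"
        by (auto simp: parcs_mk_symmetric arcs_ends_def arc_to_ends_def)
      then show ?thesis
        using w w' by (auto simp: reachable_def intro: rtrancl_on_into_rtrancl_on)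
    qed (use w in simp)
    have "closed ?A" "closed ?B"
      using fin cl by (auto intro!: closed_UN)
    moreover have "?A \<inter> ?B = {}"
      using step by blast
    ultimately have "?A \<inter> (\<Union>u\<in>verts H. Y u) = {} \<or> ?B \<inter> (\<Union>u\<in>verts H. Y u) = {}"
      by (intro connected_closedD[OF conn]) auto
    moreover have "Y u \<noteq> {}" "Y v \<noteq> {}"
      using nonempty u v by auto
    ultimately show False
      using uR u v nv by blast
  qed
  then show ?thesis
    unfolding Digraph_Component.connected_def
    using ne by (intro strongly_connectedI) auto
qed

section \<open>The chain pseudometric\<close>

text \<open>The one-member chain given by the empty word makes the set of chain sums nonempty, so
  that its \<open>Inf\<close> is a genuine greatest lower bound.\<close>

lemma chain_joining_Nil:
  assumes "w \<in> infinite_words M" "w' \<in> infinite_words M"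
  shows "chain_joining M G w w' [[]]"
  using assms by (simp add: chain_joining_def cylinder_Nil)

lemma chain_pseudometric_le:
  assumes "\<And>v. v \<in> words M \<Longrightarrow> 0 \<le> \<Delta> v" and "chain_joining M G w w' vs"
  shows "chain_pseudometric M G \<Delta> w w' \<le> sum_list (map \<Delta> vs)"
  unfolding chain_pseudometric_def
proof (rule cInf_lower)
  show "bdd_below {sum_list (map \<Delta> vs) |vs. chain_joining M G w w' vs}"
    using assms(1) by (intro bdd_belowI[of _ 0]) (fastforce simp: chain_joining_def intro!: sum_list_nonneg)
qed (use assms(2) in blast)

lemma le_chain_pseudometric:
  assumes "w \<in> infinite_words M" "w' \<in> infinite_words M"
    and "\<And>vs. chain_joining M G w w' vs \<Longrightarrow> c \<le> sum_list (map \<Delta> vs)"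
  shows "c \<le> chain_pseudometric M G \<Delta> w w'"
  unfolding chain_pseudometric_def
  by (rule cInf_greatest) (use assms chain_joining_Nil in blast)+

lemma chain_joining_rev:
  assumes "\<And>u v. combinatorially_intersect M G u v \<Longrightarrow> combinatorially_intersect M G v u"
    and "chain_joining M G w w' vs"
  shows "chain_joining M G w' w (rev vs)"
  using assms(2)
  by (auto simp: chain_joining_def hd_rev last_rev intro: successively_mono assms(1))

lemma chain_pseudometric_commute:
  assumes "\<And>u v. combinatorially_intersect M G u v \<Longrightarrow> combinatorially_intersect M G v u"
  shows "chain_pseudometric M G \<Delta> w w' = chain_pseudometric M G \<Delta> w' w"
proof -
  have "\<exists>us. sum_list (map \<Delta> vs) = sum_list (map \<Delta> us) \<and> chain_joining M G w' w us"
    if "chain_joining M G w w' vs" for w w' vs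
    using chain_joining_rev[OF assms that] by (metis rev_map sum_list_rev)
  then have "{sum_list (map \<Delta> vs) |vs. chain_joining M G w w' vs} =
      {sum_list (map \<Delta> vs) |vs. chain_joining M G w' w vs}"
    by blast
  then show ?thesis
    by (simp add: chain_pseudometric_def)
qed

text \<open>The last cylinder of \<open>us\<close> and the first of \<open>vs\<close> share
  \<open>y\<close>, and the first assumption turns this into an admissible link.\<close>

lemma chain_joining_append:
  assumes "\<And>u v. u \<in> words M \<Longrightarrow> v \<in> words M \<Longrightarrow> cylinder M u \<inter> cylinder M v \<noteq> {} \<Longrightarrow>
      combinatorially_intersect M G u v"
    and "chain_joining M G x y us" "chain_joining M G y z vs"
  shows "chain_joining M G x z (us @ vs)"
proof -
  have "combinatorially_intersect M G (last us) (hd vs)"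
    using assms(2,3) by (intro assms(1)) (auto simp: chain_joining_def)
  then show ?thesis
    using assms(2,3) by (auto simp: chain_joining_def successively_append_iff)
qed

lemma chain_pseudometric_triangle:
  assumes "\<And>v. v \<in> words M \<Longrightarrow> 0 \<le> \<Delta> v"
    and ci: "\<And>u v. u \<in> words M \<Longrightarrow> v \<in> words M \<Longrightarrow> cylinder M u \<inter> cylinder M v \<noteq> {} \<Longrightarrow>
      combinatorially_intersect M G u v"
    and x: "x \<in> infinite_words M" and y: "y \<in> infinite_words M" and z: "z \<in> infinite_words M"
  shows "chain_pseudometric M G \<Delta> x z \<le> chain_pseudometric M G \<Delta> x y + chain_pseudometric M G \<Delta> y z"
proof -
  let ?D = "chain_pseudometric M G \<Delta>"
  \<comment> \<open>The infimum is taken over one chain at a time: first over \<open>vs\<close> with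
    \<open>us\<close> fixed, then over \<open>us\<close>.\<close>
  have "?D x z - sum_list (map \<Delta> us) \<le> sum_list (map \<Delta> vs)"
    if "chain_joining M G x y us" "chain_joining M G y z vs" for us vs
    using chain_pseudometric_le[of M \<Delta>, OF assms(1) chain_joining_append[OF ci that]] by simp
  then have "?D x z - sum_list (map \<Delta> us) \<le> ?D y z" if "chain_joining M G x y us" for us
    using le_chain_pseudometric[OF y z] that by blast
  then have "?D x z - ?D y z \<le> sum_list (map \<Delta> us)" if "chain_joining M G x y us" for us
    using that by (smt (verit))
  then have "?D x z - ?D y z \<le> ?D x y"
    using le_chain_pseudometric[OF x y] by blast
  then show ?thesis
    by simp
qed

text \<open>The two estimates force the pseudometric to vanish exactly on pairs with the same image
  under \<open>p\<close>. The points of the quotient are therefore the fibres of \<open>p\<close>,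
  and sending a point to its fibre is the required map.\<close>

lemma chain_space_bilipschitz:
  fixes p :: "(nat \<Rightarrow> nat) \<Rightarrow> 'a::metric_space"
  assumes onto: "p ` infinite_words M = X" and L: "1 \<le> L"
    and lower: "\<And>w v. w \<in> infinite_words M \<Longrightarrow> v \<in> infinite_words M \<Longrightarrow>
      inverse L * dist (p w) (p v) \<le> chain_pseudometric M G \<Delta> w v"
    and upper: "\<And>w v. w \<in> infinite_words M \<Longrightarrow> v \<in> infinite_words M \<Longrightarrow>
      chain_pseudometric M G \<Delta> w v \<le> L * dist (p w) (p v)"
    and comm: "\<And>w v. chain_pseudometric M G \<Delta> w v = chain_pseudometric M G \<Delta> v w"
    and triangle: "\<And>x y z. x \<in> infinite_words M \<Longrightarrow> y \<in> infinite_words M \<Longrightarrow> z \<in> infinite_words M \<Longrightarrow>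
      chain_pseudometric M G \<Delta> x z \<le> chain_pseudometric M G \<Delta> x y + chain_pseudometric M G \<Delta> y z"
  shows "Metric_space (chain_space M G \<Delta>) (chain_metric M G \<Delta>)"
    and "bilipschitz_homeomorphic X dist (chain_space M G \<Delta>) (chain_metric M G \<Delta>)"
proof -
  let ?D = "chain_pseudometric M G \<Delta>" and ?W = "infinite_words M"
  let ?S = "chain_space M G \<Delta>" and ?d = "chain_metric M G \<Delta>"
  define f where "f x = {w \<in> ?W. p w = x}" for x
  have nonneg: "0 \<le> ?D w v" if "w \<in> ?W" "v \<in> ?W" for w v
    using lower[OF that] L by (smt (verit) mult_nonneg_nonneg inverse_nonnegative_iff_nonnegative zero_le_dist)
  have zero: "?D w v = 0 \<longleftrightarrow> p w = p v" if "w \<in> ?W" "v \<in> ?W" for w v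
  proof
    assume "?D w v = 0"
    then show "p w = p v"
      using lower[OF that] L by (simp add: mult_le_0_iff)
  next
    assume "p w = p v"
    then show "?D w v = 0"
      using upper[OF that] nonneg[OF that] by simp
  qed
  have S_eq: "?S = f ` X"
  proof -
    have "{(w, w'). w \<in> ?W \<and> w' \<in> ?W \<and> ?D w w' = 0} `` {w} = f (p w)" if "w \<in> ?W" for w
      using that zero by (auto simp: f_def)
    then show ?thesis
      by (auto simp: chain_space_def quotient_def onto[symmetric])
  qed
  \<comment> \<open>\<open>the_elem\<close> is meaningful only on a singleton: moving either
    representative within its fibre costs distance 0, so the triangle inequality leaves a single
    value.\<close>
  have d_eq: "?d (f (p w)) (f (p v)) = ?D w v" if w: "w \<in> ?W" and v: "v \<in> ?W" for w v
  proof -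
    have "?D w' v' = ?D w v" if "w' \<in> f (p w)" "v' \<in> f (p v)" for w' v'
    proof -
      have W: "w' \<in> ?W" "v' \<in> ?W" and "?D w w' = 0" "?D v' v = 0"
        using that w v zero by (auto simp: f_def)
      then have "?D w' v' \<le> ?D w v" "?D w v \<le> ?D w' v'"
        using triangle[of w' w v'] triangle[of w v v'] triangle[of w w' v] triangle[of w' v' v]
          comm[of w w'] comm[of v v'] w v by auto
      then show ?thesis
        by simp
    qed
    moreover have "w \<in> f (p w)" "v \<in> f (p v)"
      using w v by (auto simp: f_def)
    ultimately have "{?D w' v' |w' v'. w' \<in> f (p w) \<and> v' \<in> f (p v)} = {?D w v}"
      by blast
    moreover have "f (p w) \<in> ?S" "f (p v) \<in> ?S"
      using w v onto S_eq by auto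
    ultimately show ?thesis
      by (simp add: chain_metric_def)
  qed
  have repr: "\<exists>w\<in>?W. P = f (p w)" if "P \<in> ?S" for P
    using that S_eq onto by auto
  show "Metric_space ?S ?d"
  proof
    fix P Q
    \<comment> \<open>\<open>Metric_space\<close> demands nonnegativity and symmetry for all
      arguments; off the carrier they hold because \<open>chain_metric\<close> is 0 there.\<close>
    show "0 \<le> ?d P Q"
    proof (cases "P \<in> ?S \<and> Q \<in> ?S")
      case True
      then show ?thesis
        using repr d_eq nonneg by metis
    qed (auto simp: chain_metric_def)
    show "?d P Q = ?d Q P"
    proof (cases "P \<in> ?S \<and> Q \<in> ?S")
      case True
      then show ?thesis
        using repr d_eq comm by metis
    qed (auto simp: chain_metric_def)
  next
    fix P Q assume "P \<in> ?S" "Q \<in> ?S"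
    then obtain w v where wv: "w \<in> ?W" "v \<in> ?W" and PQ: "P = f (p w)" "Q = f (p v)"
      using repr by metis
    have "f (p w) = f (p v) \<longleftrightarrow> p w = p v"
      using wv by (auto simp: f_def)
    then show "?d P Q = 0 \<longleftrightarrow> P = Q"
      using wv PQ d_eq zero by simp
  next
    fix P Q R assume "P \<in> ?S" "Q \<in> ?S" "R \<in> ?S"
    then obtain w v u where "w \<in> ?W" "v \<in> ?W" "u \<in> ?W" "P = f (p w)" "Q = f (p v)" "R = f (p u)"
      using repr by metis
    then show "?d P R \<le> ?d P Q + ?d Q R"
      using d_eq triangle by simp
  qed
  show "bilipschitz_homeomorphic X dist ?S ?d"
    unfolding bilipschitz_homeomorphic_def
  proof (intro exI conjI ballI)
    have "inj_on f X"
      using onto by (auto simp: inj_on_def f_def)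
    then show "bij_betw f X ?S"
      by (simp add: bij_betw_def S_eq)
    show "1 \<le> L"
      by (fact L)
    fix x y assume "x \<in> X" "y \<in> X"
    then obtain w v where "w \<in> ?W" "v \<in> ?W" "x = p w" "y = p v"
      using onto by auto
    then show "inverse L * dist x y \<le> ?d (f x) (f y)" "?d (f x) (f y) \<le> L * dist x y"
      using d_eq lower upper by simp_all
  qed
qed

section \<open>Trees of cells\<close>

locale cell_tree =
  fixes X :: "'a::metric_space set" and M :: nat and r C :: real and Y :: "nat list \<Rightarrow> 'a set"
  assumes compact_X: "compact X" and M: "2 \<le> M" and r0: "0 < r" and r1: "r < 1" and C: "1 < C"
    and cell: "\<And>w. w \<in> words M \<Longrightarrow>
           Y w \<noteq> {} \<and> Y w \<subseteq> X \<and> closed (Y w) \<and> Topological_Spaces.connected (Y w)"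
    and cell_Nil: "Y [] = X"
    and cell_children: "\<And>w. w \<in> words M \<Longrightarrow> (\<Union>i\<in>{1..M}. Y (w @ [i])) = Y w"
    and cell_diameter: "\<And>w. w \<in> words M \<Longrightarrow> diameter (Y w) \<le> C * r ^ length w"
    and cell_setdist: "\<And>k w u. w \<in> words_of_length M k \<Longrightarrow> u \<in> words_of_length M k \<Longrightarrow>
           Y w \<inter> Y u = {} \<Longrightarrow> inverse C * r ^ k \<le> setdist (Y w) (Y u)"
begin

abbreviation "G \<equiv> intersection_graph M Y"

abbreviation "D \<equiv> chain_pseudometric M G (\<lambda>w. r ^ length w)"

section \<open>Cells of prefixes and descendants\<close>

lemma cell_childE:
  assumes "w \<in> words M" "x \<in> Y w"
  obtains i where "i \<in> {1..M}" "x \<in> Y (w @ [i])"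
  using cell_children assms by blast

lemma cell_append_subset: "u \<in> words M \<Longrightarrow> v \<in> words M \<Longrightarrow> Y (u @ v) \<subseteq> Y u"
proof (induction v rule: rev_induct)
  case (snoc i v)
  then have "Y ((u @ v) @ [i]) \<subseteq> Y (u @ v)"
    using cell_children[of "u @ v"] by auto
  with snoc show ?case
    by auto
qed simp

lemma cell_prefix_subset: "v \<in> words M \<Longrightarrow> prefix u v \<Longrightarrow> Y v \<subseteq> Y u"
  using cell_append_subset by (force simp: prefix_def)

lemma cell_descendant:
  assumes "w \<in> words M" "x \<in> Y w"
  shows "\<exists>v\<in>words_of_length M n. x \<in> Y (w @ v)"
proof (induction n)
  case 0
  then show ?case
    using assms by (auto simp: words_of_length_def)
next
  case (Suc n)
  then obtain v where v: "v \<in> words_of_length M n" "x \<in> Y (w @ v)"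
    by blast
  then have "w @ v \<in> words M"
    using assms by (simp add: words_of_length_def)
  then obtain i where "i \<in> {1..M}" "x \<in> Y ((w @ v) @ [i])"
    using v(2) by (rule cell_childE)
  with v(1) show ?case
    by (intro bexI[of _ "v @ [i]"]) (auto simp: words_of_length_def)
qed

lemma cell_descendant_at_level:
  assumes "w \<in> words M" "x \<in> Y w" "length w \<le> n"
  obtains v where "v \<in> words_of_length M n" "prefix w v" "x \<in> Y v"
proof -
  obtain u where "u \<in> words_of_length M (n - length w)" "x \<in> Y (w @ u)"
    using cell_descendant assms by blast
  then show ?thesis
    using assms by (intro that[of "w @ u"]) (auto simp: words_of_length_def)
qed

section \<open>The intersection graphs form combinatorial data\<close>

lemma pair_graph_G: "pair_graph (G k)"
proof
  show "finite (parcs (G k))"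
    by (rule finite_subset[of _ "words_of_length M k \<times> words_of_length M k"])
       (auto simp: intersection_graph_def finite_words_of_length)
  show "symmetric (with_proj (G k))"
    by (auto simp: intersection_graph_def symmetric_def sym_def Int_commute)
qed (auto simp: intersection_graph_def finite_words_of_length)

text \<open>The cells of level \<open>k\<close> cover \<open>X\<close>, which is the cell of the
  empty word and hence connected.\<close>

lemma connected_G: "Digraph_Component.connected (with_proj (G k))"
proof (rule connected_intersection_digraph[where Y = Y])
  have "(\<Union>u\<in>words_of_length M k. Y u) = X"
    using cell cell_Nil cell_descendant[of "[]" _ k] by (fastforce simp: words_of_length_def)
  then show "Topological_Spaces.connected (\<Union>u\<in>verts (with_proj (G k)). Y u)"
    using cell[of "[]"] cell_Nil by (simp add: intersection_graph_def)
  have "replicate k 1 \<in> words_of_length M k"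
    using M by (auto simp: words_of_length_def words_def in_lists_conv_set)
  then show "verts (with_proj (G k)) \<noteq> {}"
    by (auto simp: intersection_graph_def)
qed (use cell finite_words_of_length in
    \<open>auto simp: intersection_graph_def dest: words_of_length_subset\<close>)

lemma connected_children:
  assumes "w \<in> words_of_length M k"
  shows "Digraph_Component.connected (with_proj (G (Suc k)) \<restriction> ((\<lambda>i. w @ [i]) ` {1..M}))"
proof -
  have w: "w \<in> words M" "length w = k"
    using assms by (auto simp: words_of_length_def)
  show ?thesis
  proof (rule connected_intersection_digraph[where Y = Y])
    show "Topological_Spaces.connected
        (\<Union>u\<in>verts (with_proj (G (Suc k)) \<restriction> ((\<lambda>i. w @ [i]) ` {1..M})). Y u)"
      using cell cell_children w by simp
  qed (use cell w M in \<open>auto simp: intersection_graph_def words_of_length_def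
        arcs_ends_def arc_to_ends_def image_iff\<close>)
qed

lemma combinatorial_data_G: "combinatorial_data M G"
  unfolding combinatorial_data_def
proof (intro conjI allI ballI impI)
  fix k w u assume "(w, u) \<in> parcs (G k)"
  then have wu: "w \<in> words M" "u \<in> words M" "length w = k" "length u = k" "w \<noteq> u"
    and meet: "Y w \<inter> Y u \<noteq> {}"
    by (auto simp: intersection_graph_def words_of_length_def)
  \<comment> \<open>A single common point \<open>x\<close> suffices: it lies in some child cell on
    each side, and the two children are distinct because their parents are.\<close>
  obtain x where x: "x \<in> Y w" "x \<in> Y u"
    using meet by blast
  obtain i where i: "i \<in> {1..M}" "x \<in> Y (w @ [i])"
    using wu(1) x(1) by (rule cell_childE)
  obtain j where j: "j \<in> {1..M}" "x \<in> Y (u @ [j])"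
    using wu(2) x(2) by (rule cell_childE)
  have "(w @ [i], u @ [j]) \<in> parcs (G (Suc k))"
    using wu i j by (auto simp: intersection_graph_def words_of_length_def)
  then show "\<exists>i\<in>{1..M}. \<exists>j\<in>{1..M}. (w @ [i], u @ [j]) \<in> parcs (G (Suc k))"
    using i j by blast
next
  show "pverts (G k) = words_of_length M k" for k
    by (simp add: intersection_graph_def)
qed (use M pair_graph_G connected_G connected_children in blast)+

text \<open>Otherwise the first child cell and the union of the remaining ones would disconnect
  \<open>Y w\<close>; there are remaining ones since \<open>M\<close> is at least 2. This provides
  edges below a single cell, where a loop-free graph offers no edge from a word to itself.\<close>

lemma siblings_meet:
  assumes "w \<in> words M"
  obtains i j where "i \<in> {1..M}" "j \<in> {1..M}" "i \<noteq> j" "Y (w @ [i]) \<inter> Y (w @ [j]) \<noteq> {}"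
proof -
  let ?B = "\<Union>i\<in>{2..M}. Y (w @ [i])"
  have cells: "closed (Y (w @ [i]))" "Y (w @ [i]) \<noteq> {}" "Y (w @ [i]) \<subseteq> Y w" if "i \<in> {1..M}" for i
    using that assms cell cell_children[OF assms] by auto
  have cover: "Y w \<subseteq> Y (w @ [1]) \<union> ?B"
  proof
    fix x assume "x \<in> Y w"
    then obtain i where i: "i \<in> {1..M}" "x \<in> Y (w @ [i])"
      using cell_children[OF assms] by blast
    then show "x \<in> Y (w @ [1]) \<union> ?B"
      by (cases "i = 1") auto
  qed
  have "Y (w @ [1]) \<inter> ?B \<noteq> {}"
  proof
    assume disj: "Y (w @ [1]) \<inter> ?B = {}"
    have "Y (w @ [1]) \<inter> Y w = {} \<or> ?B \<inter> Y w = {}"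
    proof (rule connected_closedD[OF _ _ cover])
      show "closed (Y (w @ [1]))" "closed ?B"
        using cells(1) M by (auto intro!: closed_UN)
    qed (use disj cell assms in auto)
    moreover have "Y (w @ [1]) \<inter> Y w \<noteq> {}" "Y (w @ [2]) \<inter> Y w \<noteq> {}"
      using cells(2,3)[of 1] cells(2,3)[of 2] M by auto
    moreover have "2 \<in> {2..M}"
      using M by simp
    ultimately show False
      by blast
  qed
  then obtain j where "j \<in> {2..M}" "Y (w @ [1]) \<inter> Y (w @ [j]) \<noteq> {}"
    by blast
  then show ?thesis
    using M by (intro that[of 1 j]) auto
qed

text \<open>Adjacent words must be distinct, so a common point of \<open>Y u\<close> and
  \<open>Y v\<close> is not enough by itself. Extending \<open>u\<close> and \<open>v\<close> to
  incomparable words with meeting cells cures this, since extensions of incomparable words never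
  coincide.\<close>

lemma combinatorially_intersect_iff:
  assumes u: "u \<in> words M" and v: "v \<in> words M"
  shows "combinatorially_intersect M G u v \<longleftrightarrow> Y u \<inter> Y v \<noteq> {}"
proof
  assume "combinatorially_intersect M G u v"
  then obtain u' v' where "u' \<in> words M" "v' \<in> words M" "prefix u u'" "prefix v v'" "Y u' \<inter> Y v' \<noteq> {}"
    unfolding combinatorially_intersect_def intersection_graph_def
    by (fastforce simp: words_of_length_def)
  then show "Y u \<inter> Y v \<noteq> {}"
    using cell_prefix_subset by blast
next
  assume meet: "Y u \<inter> Y v \<noteq> {}"
  \<comment> \<open>At most one extra letter is allowed, because the levels to be served begin at
    \<open>Suc (max (length u) (length v))\<close>.\<close>
  obtain u' v' where uv': "u' \<in> words M" "v' \<in> words M" "prefix u u'" "prefix v v'" "u' \<parallel> v'"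
    "Y u' \<inter> Y v' \<noteq> {}" "length u' \<le> Suc (max (length u) (length v))"
    "length v' \<le> Suc (max (length u) (length v))"
  proof (cases "u \<parallel> v")
    case True
    then show ?thesis
      using that[of u v] u v meet by auto
  next
    case False
    \<comment> \<open>For comparable words \<open>z\<close> is the longer one, and two of its
      children with meeting cells serve as \<open>u'\<close> and \<open>v'\<close>.\<close>
    then obtain z where z: "z \<in> {u, v}" "prefix u z" "prefix v z"
      by (auto simp: parallel_def)
    obtain i j where "i \<in> {1..M}" "j \<in> {1..M}" "i \<noteq> j" "Y (z @ [i]) \<inter> Y (z @ [j]) \<noteq> {}"
      using siblings_meet[of z] z u v by blast
    then show ?thesis
      using z u v by (intro that[of "z @ [i]" "z @ [j]"]) auto
  qed
  obtain x where x: "x \<in> Y u'" "x \<in> Y v'"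
    using uv' by blast
  show "combinatorially_intersect M G u v"
    unfolding combinatorially_intersect_def
  proof (intro allI impI)
    fix n assume "max (length u) (length v) < n"
    then have n: "length u' \<le> n" "length v' \<le> n"
      using uv' by auto
    obtain a where a: "a \<in> words_of_length M n" "prefix u' a" "x \<in> Y a"
      by (rule cell_descendant_at_level[OF uv'(1) x(1) n(1)])
    obtain b where b: "b \<in> words_of_length M n" "prefix v' b" "x \<in> Y b"
      by (rule cell_descendant_at_level[OF uv'(2) x(2) n(2)])
    have "a \<noteq> b"
      using a b uv'(5) by (auto simp: parallel_def dest: prefix_same_cases)
    then have "(a, b) \<in> parcs (G n)"
      using a b by (auto simp: intersection_graph_def)
    moreover have "prefix u a" "prefix v b"
      using a b uv' prefix_order.trans by blast+
    ultimately show "\<exists>w1\<in>words_of_length M n. \<exists>w2\<in>words_of_length M n.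
          prefix u w1 \<and> prefix v w2 \<and> (w1, w2) \<in> parcs (G n)"
      using a b by blast
  qed
qed

lemma combinatorially_intersect_commute:
  "combinatorially_intersect M G u v \<Longrightarrow> combinatorially_intersect M G v u"
proof -
  have "(w, w') \<in> parcs (G n) \<Longrightarrow> (w', w) \<in> parcs (G n)" for w w' n
    by (auto simp: intersection_graph_def)
  then show "combinatorially_intersect M G u v \<Longrightarrow> combinatorially_intersect M G v u"
    unfolding combinatorially_intersect_def max.commute[of "length v"] by blast
qed

subsection \<open>Coding points by infinite words\<close>

text \<open>The choice is harmless: a point exists by compactness (\<open>point_in_cell\<close>) and
  is unique because the diameters tend to 0 (\<open>point_eqI\<close>).\<close>

definition point :: "(nat \<Rightarrow> nat) \<Rightarrow> 'a" where
  "point w = (SOME x. \<forall>n. x \<in> Y (map w [0..<n]))"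

lemma point_in_cell:
  assumes w: "w \<in> infinite_words M"
  shows "point w \<in> Y (map w [0..<n])"
proof -
  have words: "map w [0..<n] \<in> words M" for n
    by (rule map_upt_in_words[OF w])
  have mono: "Y (map w [0..<n]) \<subseteq> Y (map w [0..<m])" if "m \<le> n" for m n
  proof (rule cell_prefix_subset[OF words])
    show "prefix (map w [0..<m]) (map w [0..<n])"
      using that upt_add_eq_append[of 0 m "n - m"] by (simp add: prefix_def)
  qed
  have "X \<inter> (\<Inter>n. Y (map w [0..<n])) \<noteq> {}"
  proof (rule compact_imp_fip_image[OF compact_X])
    fix I :: "nat set" assume I: "finite I"
    obtain m where "\<forall>n\<in>I. n \<le> m"
      using I by (meson Max_ge)
    \<comment> \<open>The cells are nested, so a finite subfamily contains the nonempty cell of any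
      level \<open>m\<close> bounding its indices.\<close>
    then have "Y (map w [0..<m]) \<subseteq> X \<inter> (\<Inter>n\<in>I. Y (map w [0..<n]))"
      using mono cell[OF words] by blast
    then show "X \<inter> (\<Inter>n\<in>I. Y (map w [0..<n])) \<noteq> {}"
      using cell[OF words] by blast
  qed (use cell words in blast)
  then have "\<exists>x. \<forall>n. x \<in> Y (map w [0..<n])"
    by blast
  then have "\<forall>n. point w \<in> Y (map w [0..<n])"
    unfolding point_def by (rule someI_ex)
  then show ?thesis
    by blast
qed

lemma dist_le_cell:
  assumes "w \<in> words M" "x \<in> Y w" "y \<in> Y w"
  shows "dist x y \<le> C * r ^ length w"
proof -
  have "bounded (Y w)"
    using cell[OF assms(1)] compact_X bounded_subset compact_imp_bounded by blast
  then show ?thesis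
    using diameter_bounded_bound[OF _ assms(2,3)] cell_diameter[OF assms(1)] by linarith
qed

lemma point_eqI:
  assumes w: "w \<in> infinite_words M" and x: "\<And>n. x \<in> Y (map w [0..<n])"
  shows "point w = x"
proof -
  have "(\<lambda>n. C * r ^ n) \<longlonglongrightarrow> C * 0"
    using r0 r1 by (intro tendsto_mult_left LIMSEQ_realpow_zero) auto
  moreover have "dist (point w) x \<le> C * r ^ n" for n
    using dist_le_cell[OF map_upt_in_words[OF w] point_in_cell[OF w] x, of n] by simp
  ultimately have "dist (point w) x \<le> C * 0"
    by (intro LIMSEQ_le_const) auto
  then show ?thesis
    by simp
qed

lemma point_onto: "point ` infinite_words M = X"
proof
  show "point ` infinite_words M \<subseteq> X"
    using point_in_cell[of _ 0] cell_Nil by auto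
  show "X \<subseteq> point ` infinite_words M"
  proof
    fix x assume "x \<in> X"
    \<comment> \<open>Dependent choice descends through cells containing \<open>x\<close>, adding
      one letter at a time.\<close>
    then have "\<exists>f. \<forall>n. (f n \<in> words_of_length M n \<and> x \<in> Y (f n)) \<and>
        (\<exists>i\<in>{1..M}. f (Suc n) = f n @ [i])"
    proof (intro dependent_nat_choice)
      show "\<exists>u. u \<in> words_of_length M 0 \<and> x \<in> Y u"
        using \<open>x \<in> X\<close> cell_Nil by (auto simp: words_of_length_def)
      fix u n assume u: "u \<in> words_of_length M n \<and> x \<in> Y u"
      then obtain i where "i \<in> {1..M}" "x \<in> Y (u @ [i])"
        using cell_childE[of u x] words_of_length_subset by blast
      then show "\<exists>v. (v \<in> words_of_length M (Suc n) \<and> x \<in> Y v) \<and> (\<exists>i\<in>{1..M}. v = u @ [i])"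
        using u by (intro exI[of _ "u @ [i]"]) (auto simp: words_of_length_def)
    qed
    then obtain f where f: "\<And>n. f n \<in> words_of_length M n" "\<And>n. x \<in> Y (f n)"
      and step: "\<And>n. \<exists>i\<in>{1..M}. f (Suc n) = f n @ [i]"
      by metis
    \<comment> \<open>Since \<open>f 0\<close> is empty, letter \<open>n\<close> first appears in
      \<open>f (Suc n)\<close>; the words \<open>f n\<close> become the prefixes of
      \<open>w\<close>.\<close>
    define w where "w n = last (f (Suc n))" for n
    have w: "w n \<in> {1..M}" "f (Suc n) = f n @ [w n]" for n
      using step[of n] by (auto simp: w_def)
    have "map w [0..<n] = f n" for n
      using f(1)[of 0] by (induction n) (simp_all add: w(2) words_of_length_def)
    moreover have "w \<in> infinite_words M"
      using w(1) by (simp add: infinite_words_def)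
    ultimately show "x \<in> point ` infinite_words M"
      using f(2) point_eqI by force
  qed
qed

subsection \<open>Comparison with the chain pseudometric\<close>

lemma point_in_cylinder_cell: "w \<in> cylinder M u \<Longrightarrow> point w \<in> Y u"
  using point_in_cell[of w "length u"] by (auto simp: cylinder_def)

text \<open>Each pair of consecutive cells shares a point; the path through these points crosses
  every cell once, at a cost of at most its diameter. The start \<open>x\<close> is generalized
  because the induction restarts from the first shared point.\<close>

lemma dist_le_chain:
  assumes "vs \<noteq> []" "set vs \<subseteq> words M" "successively (combinatorially_intersect M G) vs"
    and "x \<in> Y (hd vs)" "y \<in> Y (last vs)"
  shows "dist x y \<le> C * (\<Sum>v\<leftarrow>vs. r ^ length v)"
  using assms
proof (induction vs arbitrary: x)
  case (Cons u vs)
  show ?case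
  proof (cases "vs = []")
    case True
    then show ?thesis
      using Cons.prems dist_le_cell[of u x y] by simp
  next
    case False
    then have "combinatorially_intersect M G u (hd vs)"
      using Cons.prems by (simp add: successively_Cons)
    moreover have "u \<in> words M" "hd vs \<in> words M"
      using Cons.prems False by auto
    ultimately obtain z where z: "z \<in> Y u" "z \<in> Y (hd vs)"
      using combinatorially_intersect_iff by blast
    have "dist x y \<le> dist x z + dist z y"
      by (rule dist_triangle)
    also have "\<dots> \<le> C * r ^ length u + C * (\<Sum>v\<leftarrow>vs. r ^ length v)"
      using Cons.prems False z by (intro add_mono dist_le_cell Cons.IH) (auto simp: successively_Cons)
    finally show ?thesis
      by (simp add: distrib_left)
  qed
qed simp

lemma dist_point_le:
  assumes "w \<in> infinite_words M" "v \<in> infinite_words M"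
  shows "dist (point w) (point v) \<le> C * D w v"
proof -
  have "dist (point w) (point v) / C \<le> D w v"
  proof (rule le_chain_pseudometric[OF assms])
    fix vs assume "chain_joining M G w v vs"
    then have "dist (point w) (point v) \<le> C * (\<Sum>u\<leftarrow>vs. r ^ length u)"
      by (intro dist_le_chain) (auto simp: chain_joining_def point_in_cylinder_cell)
    then show "dist (point w) (point v) / C \<le> (\<Sum>u\<leftarrow>vs. r ^ length u)"
      using C by (simp add: field_simps)
  qed
  then show ?thesis
    using C by (simp add: field_simps)
qed

text \<open>The two prefixes form a chain, even when they coincide, since a cylinder combinatorially
  intersects itself.\<close>

lemma chain_pseudometric_le_level:
  assumes w: "w \<in> infinite_words M" and v: "v \<in> infinite_words M"
    and "Y (map w [0..<n]) \<inter> Y (map v [0..<n]) \<noteq> {}"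
  shows "D w v \<le> 2 * r ^ n"
proof -
  have "chain_joining M G w v [map w [0..<n], map v [0..<n]]"
    using assms combinatorially_intersect_iff
    by (simp add: chain_joining_def map_upt_in_words in_cylinder_map_upt)
  from chain_pseudometric_le[OF _ this, of "\<lambda>u. r ^ length u"] show ?thesis
    using r0 by simp
qed

lemma chain_pseudometric_le_dist:
  assumes w: "w \<in> infinite_words M" and v: "v \<in> infinite_words M"
  shows "D w v \<le> 2 * C / r * dist (point w) (point v)"
proof (cases "\<forall>n. Y (map w [0..<n]) \<inter> Y (map v [0..<n]) \<noteq> {}")
  case True
  have "(\<lambda>n. 2 * r ^ n) \<longlonglongrightarrow> 2 * 0"
    using r0 r1 by (intro tendsto_mult_left LIMSEQ_realpow_zero) auto
  then have "D w v \<le> 2 * 0"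
    by (rule LIMSEQ_le_const) (use chain_pseudometric_le_level[OF w v] True in blast)
  also have "\<dots> \<le> 2 * C / r * dist (point w) (point v)"
    using C r0 by simp
  finally show ?thesis .
next
  case False
  define disj where "disj n \<longleftrightarrow> Y (map w [0..<n]) \<inter> Y (map v [0..<n]) = {}" for n
  \<comment> \<open>At level 0 both cells are the nonempty set \<open>X\<close>, so there is a level
    \<open>n\<close> where the cells meet immediately before one where they are disjoint.\<close>
  have "\<exists>n. disj n" and "\<not> disj 0"
    using False cell[of "[]"] by (auto simp: disj_def)
  then obtain n where n: "\<not> disj n" "disj (Suc n)"
    using exists_least_lemma[of disj] by auto
  have "inverse C * r ^ Suc n \<le> setdist (Y (map w [0..<Suc n])) (Y (map v [0..<Suc n]))"
    using n(2) map_upt_in_words[OF w, of "Suc n"] map_upt_in_words[OF v, of "Suc n"]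
    by (intro cell_setdist) (auto simp: disj_def words_of_length_def)
  also have "\<dots> \<le> dist (point w) (point v)"
    using w v by (intro setdist_le_dist point_in_cell)
  \<comment> \<open>The factor \<open>1 / r\<close> pays for the gap of one level: separation is
    known at \<open>Suc n\<close>, the chain bound at \<open>n\<close>.\<close>
  finally have "2 * r ^ n \<le> 2 * C / r * dist (point w) (point v)"
    using C r0 by (simp add: field_simps)
  moreover have "D w v \<le> 2 * r ^ n"
    using n(1) chain_pseudometric_le_level[OF w v] by (simp add: disj_def)
  ultimately show ?thesis
    by linarith
qed

lemma chain_space_G:
  "Metric_space (chain_space M G (\<lambda>w. r ^ length w)) (chain_metric M G (\<lambda>w. r ^ length w))"
  "bilipschitz_homeomorphic X dist (chain_space M G (\<lambda>w. r ^ length w))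
     (chain_metric M G (\<lambda>w. r ^ length w))"
proof -
  \<comment> \<open>A single constant must serve both directions; \<open>2 * C / r\<close> from the
    upper estimate also dominates the \<open>C\<close> of the lower one.\<close>
  have L: "C \<le> 2 * C / r"
    using C r0 r1 by (simp add: field_simps)
  have lower: "inverse (2 * C / r) * dist (point w) (point v) \<le> D w v"
    if "w \<in> infinite_words M" "v \<in> infinite_words M" for w v
  proof -
    have "inverse (2 * C / r) * dist (point w) (point v) \<le> inverse C * dist (point w) (point v)"
      using L C by (intro mult_right_mono le_imp_inverse_le) auto
    also have "\<dots> \<le> D w v"
      using dist_point_le[OF that] C by (simp add: field_simps)
    finally show ?thesis .
  qed
  have triangle: "D x z \<le> D x y + D y z"
    if "x \<in> infinite_words M" "y \<in> infinite_words M" "z \<in> infinite_words M" for x y z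
  proof (rule chain_pseudometric_triangle[OF _ _ that])
    \<comment> \<open>An infinite word in both cylinders is coded by a point in both cells.\<close>
    fix u v assume "u \<in> words M" "v \<in> words M" "cylinder M u \<inter> cylinder M v \<noteq> {}"
    then show "combinatorially_intersect M G u v"
      using combinatorially_intersect_iff point_in_cylinder_cell by blast
  qed (use r0 in simp)
  have "1 \<le> 2 * C / r"
    using L C by linarith
  note * = chain_space_bilipschitz[OF point_onto this lower chain_pseudometric_le_dist
      chain_pseudometric_commute[OF combinatorially_intersect_commute] triangle]
  show "Metric_space (chain_space M G (\<lambda>w. r ^ length w)) (chain_metric M G (\<lambda>w. r ^ length w))"
    by (rule *(1))
  show "bilipschitz_homeomorphic X dist (chain_space M G (\<lambda>w. r ^ length w))
     (chain_metric M G (\<lambda>w. r ^ length w))"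
    by (rule *(2))
qed

end

theorem proposition7p1:
  fixes X :: "'a::metric_space set" and M :: nat and r C :: real
    and Y :: "nat list \<Rightarrow> 'a set"
  assumes "compact X" and "2 \<le> M" and "0 < r" and "r < 1" and "1 < C"
    and "\<And>w. w \<in> words M \<Longrightarrow>
           Y w \<noteq> {} \<and> Y w \<subseteq> X \<and> closed (Y w) \<and> Topological_Spaces.connected (Y w)"
    and "Y [] = X"
    and "\<And>w i. w \<in> words M \<Longrightarrow> i \<in> {1..M} \<Longrightarrow> Y (w @ [i]) \<subseteq> Y w"
    and "\<And>w. w \<in> words M \<Longrightarrow> (\<Union>i\<in>{1..M}. Y (w @ [i])) = Y w"
    and "\<And>w. w \<in> words M \<Longrightarrow>
           inverse C * r ^ length w \<le> diameter (Y w) \<and> diameter (Y w) \<le> C * r ^ length w"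
    and "\<And>k w u. w \<in> words_of_length M k \<Longrightarrow> u \<in> words_of_length M k \<Longrightarrow>
           Y w \<inter> Y u = {} \<Longrightarrow> inverse C * r ^ k \<le> setdist (Y w) (Y u)"
  shows "let G = intersection_graph M Y; \<Delta> = (\<lambda>w. r ^ length w) in
           combinatorial_data M G \<and>
           Metric_space (chain_space M G \<Delta>) (chain_metric M G \<Delta>) \<and>
           bilipschitz_homeomorphic X dist (chain_space M G \<Delta>) (chain_metric M G \<Delta>)"
proof -
  interpret cell_tree X M r C Y
    by (unfold_locales; use assms in blast)
  show ?thesis
    unfolding Let_def using combinatorial_data_G chain_space_G by blast
qed

end
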